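(* Let $\mathcal{H}$ be a complex Hilbert space, let $T\in\mathcal{B}(\mathcal{H})$ and let $\lambda\in(0,1)$. Then $$\|M_\lambda(T)\|=\|T\|\quad\text{if and only if}\quad\|T^2\|=\|T\|^2.$$
   Context: $\mathcal{B}(\mathcal{H})$ denotes the bounded linear operators on $\mathcal{H}$. $|T|=(T^*T)^{1/2}$, and $T=U|T|$ is the canonical polar decomposition ($U$ a partial isometry with $\ker U=\ker T$). The Duggal transform is $T^D=|T|U$, and the $\lambda$-mean transform is $M_\lambda(T)=\lambda T+(1-\lambda)T^D$. *)

theory Defs
  imports "HOL-Analysis.Analysis"
begin

(* The inner product is linear in its first argument.  Positive definiteness is
   contained in the axiom cinner_self, because norm is already known to be a norm;
   completeness comes from banach. *)
class complex_hilbert_space = banach +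
  fixes scaleC :: "complex \<Rightarrow> 'a \<Rightarrow> 'a"
    and cinner :: "'a \<Rightarrow> 'a \<Rightarrow> complex"
  assumes scaleC_add_right: "scaleC c (x + y) = scaleC c x + scaleC c y"
    and scaleC_add_left: "scaleC (c + d) x = scaleC c x + scaleC d x"
    and scaleC_scaleC: "scaleC c (scaleC d x) = scaleC (c * d) x"
    and scaleC_of_real: "scaleC (complex_of_real r) x = r *\<^sub>R x"
    and cinner_add_left: "cinner (x + y) z = cinner x z + cinner y z"
    and cinner_scaleC_left: "cinner (scaleC c x) y = c * cinner x y"
    and cinner_commute: "cinner x y = cnj (cinner y x)"
    and cinner_self: "cinner x x = complex_of_real ((norm x)\<^sup>2)"

instantiation complex :: complex_hilbert_space
begin

definition scaleC_complex :: "complex \<Rightarrow> complex \<Rightarrow> complex"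
  where "scaleC_complex c z = c * z"

definition cinner_complex :: "complex \<Rightarrow> complex \<Rightarrow> complex"
  where "cinner_complex z w = z * cnj w"

instance
proof
  fix x y z c d :: complex and r :: real
  show "scaleC c (x + y) = scaleC c x + scaleC c y"
    by (simp add: scaleC_complex_def distrib_left)
  show "scaleC (c + d) x = scaleC c x + scaleC d x"
    by (simp add: scaleC_complex_def distrib_right)
  show "scaleC c (scaleC d x) = scaleC (c * d) x"
    by (simp add: scaleC_complex_def mult.assoc)
  show "scaleC (complex_of_real r) x = r *\<^sub>R x"
    by (simp add: scaleC_complex_def scaleR_conv_of_real)
  show "cinner (x + y) z = cinner x z + cinner y z"
    by (simp add: cinner_complex_def distrib_right)
  show "cinner (scaleC c x) y = c * cinner x y"
    by (simp add: cinner_complex_def scaleC_complex_def mult.assoc)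
  show "cinner x y = cnj (cinner y x)"
    by (simp add: cinner_complex_def mult.commute)
  show "cinner x x = complex_of_real ((norm x)\<^sup>2)"
    unfolding cinner_complex_def by (rule complex_norm_square [symmetric])
qed

end

(* The type 'a \<Rightarrow>\<^sub>L 'a consists of the bounded real-linear operators with the operator
   norm.  B(H) is the set of its elements that satisfy the following predicate. *)
definition complex_linear :: "('a::complex_hilbert_space \<Rightarrow>\<^sub>L 'a) \<Rightarrow> bool"
  where "complex_linear T \<longleftrightarrow>
    (\<forall>c x. blinfun_apply T (scaleC c x) = scaleC c (blinfun_apply T x))"

definition hilbert_adjoint ::
  "('a::complex_hilbert_space \<Rightarrow>\<^sub>L 'a) \<Rightarrow> ('a \<Rightarrow>\<^sub>L 'a)"
  where "hilbert_adjoint T = (THE S. complex_linear S \<and>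
    (\<forall>x y. cinner (blinfun_apply T x) y = cinner x (blinfun_apply S y)))"

definition positive_operator :: "('a::complex_hilbert_space \<Rightarrow>\<^sub>L 'a) \<Rightarrow> bool"
  where "positive_operator A \<longleftrightarrow>
    complex_linear A \<and> (\<forall>x. cinner (blinfun_apply A x) x \<in> \<real>\<^sub>\<ge>\<^sub>0)"

definition operator_sqrt ::
  "('a::complex_hilbert_space \<Rightarrow>\<^sub>L 'a) \<Rightarrow> ('a \<Rightarrow>\<^sub>L 'a)"
  where "operator_sqrt A = (THE B. positive_operator B \<and> B o\<^sub>L B = A)"

definition operator_abs ::
  "('a::complex_hilbert_space \<Rightarrow>\<^sub>L 'a) \<Rightarrow> ('a \<Rightarrow>\<^sub>L 'a)"
  where "operator_abs T = operator_sqrt (hilbert_adjoint T o\<^sub>L T)"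

definition operator_kernel :: "('a::complex_hilbert_space \<Rightarrow>\<^sub>L 'a) \<Rightarrow> 'a set"
  where "operator_kernel T = {x. blinfun_apply T x = 0}"

definition orthogonal_complement :: "'a::complex_hilbert_space set \<Rightarrow> 'a set"
  where "orthogonal_complement M = {x. \<forall>y\<in>M. cinner x y = 0}"

definition partial_isometry :: "('a::complex_hilbert_space \<Rightarrow>\<^sub>L 'a) \<Rightarrow> bool"
  where "partial_isometry U \<longleftrightarrow> complex_linear U \<and>
    (\<forall>x\<in>orthogonal_complement (operator_kernel U). norm (blinfun_apply U x) = norm x)"

definition polar_isometry ::
  "('a::complex_hilbert_space \<Rightarrow>\<^sub>L 'a) \<Rightarrow> ('a \<Rightarrow>\<^sub>L 'a)"
  where "polar_isometry T = (THE U. partial_isometry U \<and>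
    operator_kernel U = operator_kernel T \<and> T = U o\<^sub>L operator_abs T)"

definition duggal_transform ::
  "('a::complex_hilbert_space \<Rightarrow>\<^sub>L 'a) \<Rightarrow> ('a \<Rightarrow>\<^sub>L 'a)"
  where "duggal_transform T = operator_abs T o\<^sub>L polar_isometry T"

definition mean_transform ::
  "real \<Rightarrow> ('a::complex_hilbert_space \<Rightarrow>\<^sub>L 'a) \<Rightarrow> ('a \<Rightarrow>\<^sub>L 'a)"
  where "mean_transform l T = l *\<^sub>R T + (1 - l) *\<^sub>R duggal_transform T"

end

theory Submission
  imports Defs
begin

text \<open>
  Write $A = |T|$, $t = \|T\|$ and $T^D = AU$. Since $0 \le A \le t$, one has
  $\|Ax - tx\|^2 \le t^2\|x\|^2 - \|Tx\|^2$, so $T$ almost attains its norm only at approximate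
  eigenvectors of $A$. If $M_\lambda(T)$ almost attains the norm $t$ at $x$, then so do $T$ and
  $T^D$, hence $T^2x = TUAx \approx t\,TUx$ has norm about $t\,\|T^Dx\| \approx t^2$. If $T^2$ almost
  attains the norm $t^2$ at $x$, then both $x$ and $Tx$ are approximate eigenvectors of $A$, hence
  $t\,T^Dx \approx AUAx = ATx \approx t\,Tx$ and $M_\lambda(T)x \approx Tx$.

  The square root of a positive $P$ with $\|1 - P\| \le 1$ is $1 - Y$, where $Y$ is the limit of
  $Y_{n+1} = \frac12(1 - P + Y_n^2)$; the same iteration with the number $1$ in place of $1 - P$
  majorizes the increments, so the convergence is in norm.
\<close>

section \<open>Complex inner products\<close>

lemma cinner_add_right: "cinner x (y + z) = cinner x y + cinner x z"
  by (metis cinner_commute cinner_add_left complex_cnj_add)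

lemma cinner_scaleC_right: "cinner x (scaleC c y) = cnj c * cinner x y"
  by (metis cinner_commute cinner_scaleC_left complex_cnj_mult)

lemma cinner_scaleR_left: "cinner (r *\<^sub>R x) y = of_real r * cinner x y"
  by (metis scaleC_of_real cinner_scaleC_left)

lemma cinner_scaleR_right: "cinner x (r *\<^sub>R y) = of_real r * cinner x y"
  by (metis scaleC_of_real cinner_scaleC_right complex_cnj_complex_of_real)

lemma cinner_zero_left [simp]: "cinner 0 x = 0"
  using cinner_scaleR_left[of 0 x x] by simp

lemma cinner_zero_right [simp]: "cinner x 0 = 0"
  using cinner_scaleR_right[of x 0 x] by simp

lemma cinner_diff_left: "cinner (x - y) z = cinner x z - cinner y z"
  using cinner_add_left[of "x - y" y z] by simp

lemma cinner_diff_right: "cinner z (x - y) = cinner z x - cinner z y"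
  using cinner_add_right[of z "x - y" y] by simp

lemmas cinner_simps = cinner_add_left cinner_add_right cinner_diff_left cinner_diff_right
  cinner_scaleC_left cinner_scaleC_right cinner_scaleR_left cinner_scaleR_right

lemma Re_cinner_commute: "Re (cinner x y) = Re (cinner y x)"
  by (metis cinner_commute cnj.sel(1))

lemma Re_cinner_self: "Re (cinner x x) = (norm x)\<^sup>2"
  by (simp add: cinner_self)

lemma norm_diff_sq: "(norm (x - y))\<^sup>2 = (norm x)\<^sup>2 - 2 * Re (cinner x y) + (norm y)\<^sup>2"
  for x y :: "'a::complex_hilbert_space"
  unfolding Re_cinner_self[symmetric] by (simp add: cinner_simps Re_cinner_commute[of y x])

lemma parallelogram: "(norm (x + y))\<^sup>2 + (norm (x - y))\<^sup>2 = 2 * (norm x)\<^sup>2 + 2 * (norm y)\<^sup>2"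
  for x y :: "'a::complex_hilbert_space"
  unfolding Re_cinner_self[symmetric] by (simp add: cinner_simps)

lemma cinner_eq_zero_iff [simp]: "cinner x x = 0 \<longleftrightarrow> x = 0"
  by (simp add: cinner_self)

text \<open>Testing with \<open>x - y\<close> suffices. This nondegeneracy gives uniqueness of
  adjoints, and it also yields linearity of maps known only through their inner products.\<close>

lemma cinner_ext_right:
  assumes "\<And>z. cinner z x = cinner z y"
  shows "x = y"
  using assms[of "x - y"] cinner_eq_zero_iff[of "x - y"] by (simp add: cinner_diff_right)

lemma norm_scaleC: "norm (scaleC c x) = cmod c * norm x"
proof -
  have "complex_of_real ((norm (scaleC c x))\<^sup>2) = c * cnj c * cinner x x"
    unfolding cinner_self[symmetric] by (simp add: cinner_simps)
  also have "\<dots> = complex_of_real ((cmod c * norm x)\<^sup>2)"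
    by (simp only: cinner_self power_mult_distrib of_real_mult complex_norm_square)
  finally have "(norm (scaleC c x))\<^sup>2 = (cmod c * norm x)\<^sup>2"
    by (simp only: of_real_eq_iff)
  then show ?thesis by simp
qed

lemma cinner_Cauchy_Schwarz: "cmod (cinner x y) \<le> norm x * norm y"
proof (cases "y = 0")
  case False
  \<comment> \<open>\<open>u\<close> is \<open>(norm y)\<^sup>2\<close> times the projection of
    \<open>x\<close> to the line of \<open>y\<close>. Expanding the squared norm of the equally
    scaled residual avoids division.\<close>
  define u where "u = scaleC (cinner x y) y"
  have 1: "Re (cinner x u) = (cmod (cinner x y))\<^sup>2"
    unfolding u_def cinner_simps by (simp add: cmod_power2 flip: power2_eq_square)
  have "0 \<le> (norm ((norm y)\<^sup>2 *\<^sub>R x - u))\<^sup>2"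
    by simp
  also have "\<dots> = (norm y)\<^sup>2 * ((norm y)\<^sup>2 * (norm x)\<^sup>2 - (cmod (cinner x y))\<^sup>2)"
    unfolding norm_diff_sq by (simp add: cinner_simps 1)
      (simp add: u_def norm_scaleC power_mult_distrib algebra_simps power2_eq_square)
  finally have "(cmod (cinner x y))\<^sup>2 \<le> (norm x * norm y)\<^sup>2"
    using False by (simp add: zero_le_mult_iff power_mult_distrib mult.commute)
  then show ?thesis
    by (rule power2_le_imp_le) simp
qed simp

text \<open>Conjugate linearity in the second argument is still linearity over the reals, and this
  is enough to inherit the limit rules.\<close>

lemma bounded_bilinear_cinner:
  "bounded_bilinear (cinner :: 'a::complex_hilbert_space \<Rightarrow> 'a \<Rightarrow> complex)"
  by standard (auto simp: cinner_simps scaleR_conv_of_real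
      intro!: exI[of _ 1] cinner_Cauchy_Schwarz)

lemmas tendsto_cinner [tendsto_intros] = bounded_bilinear.tendsto[OF bounded_bilinear_cinner]

lemma bounded_linear_scaleC: "bounded_linear (scaleC c)"
proof (rule bounded_linear_intro)
  show "scaleC c (r *\<^sub>R x) = r *\<^sub>R scaleC c x" for r and x :: 'a
    unfolding scaleC_of_real[symmetric] scaleC_scaleC by (simp add: mult.commute)
  show "norm (scaleC c x) \<le> norm x * cmod c" for x :: 'a
    by (simp add: norm_scaleC mult.commute)
qed (rule scaleC_add_right)

lemmas tendsto_scaleC [tendsto_intros] = bounded_linear.tendsto[OF bounded_linear_scaleC]

lemma scaleC_diff_right: "scaleC c (x - y) = scaleC c x - scaleC c y"
  by (rule linear_diff[OF bounded_linear.linear[OF bounded_linear_scaleC]])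

lemma scaleC_zero_right [simp]: "scaleC c 0 = 0"
  by (rule linear_0[OF bounded_linear.linear[OF bounded_linear_scaleC]])

lemma scaleC_scaleR: "scaleC c (r *\<^sub>R x) = r *\<^sub>R scaleC c x"
  by (rule linear_scale[OF bounded_linear.linear[OF bounded_linear_scaleC]])


section \<open>Orthogonal projection and Riesz representation\<close>

text \<open>A minimizing sequence is Cauchy: by convexity the midpoint of two terms stays in
  \<open>M\<close>, so its squared distance to \<open>x\<close> is at least the infimum
  \<open>D\<close>, and the parallelogram identity turns this into a bound on the gap between the
  terms.\<close>

lemma nearest_point_exists:
  fixes M :: "'a::complex_hilbert_space set"
  assumes M: "closed M" "convex M" "M \<noteq> {}"
  obtains m where "m \<in> M" "\<And>y. y \<in> M \<Longrightarrow> norm (x - m) \<le> norm (x - y)"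
proof -
  define D where "D = (INF y\<in>M. (norm (x - y))\<^sup>2)"
  have bdd: "bdd_below ((\<lambda>y. (norm (x - y))\<^sup>2) ` M)"
    by (rule bdd_belowI[of _ 0]) auto
  have lower: "D \<le> (norm (x - y))\<^sup>2" if "y \<in> M" for y
    unfolding D_def using bdd that by (rule cINF_lower)
  have "\<exists>y\<in>M. (norm (x - y))\<^sup>2 < D + inverse (Suc n)" for n
    using cINF_less_iff[OF M(3) bdd, of "D + inverse (Suc n)"] unfolding D_def by simp
  then obtain Y where Y: "\<And>n. Y n \<in> M" "\<And>n. (norm (x - Y n))\<^sup>2 < D + inverse (Suc n)"
    by metis
  have gap: "(norm (Y i - Y j))\<^sup>2 \<le> 2 * inverse (Suc i) + 2 * inverse (Suc j)" for i j
  proof -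
    have "(1/2) *\<^sub>R Y i + (1/2) *\<^sub>R Y j \<in> M"
      using M(2) Y(1) by (intro convexD) auto
    then have "D \<le> (norm (x - ((1/2) *\<^sub>R Y i + (1/2) *\<^sub>R Y j)))\<^sup>2"
      by (rule lower)
    also have "x - ((1/2) *\<^sub>R Y i + (1/2) *\<^sub>R Y j) = (1/2) *\<^sub>R ((x - Y i) + (x - Y j))"
      using scaleR_left_distrib[of "1/2" "1/2" x] by (simp add: scaleR_diff_right scaleR_add_right)
    finally have "4 * D \<le> (norm ((x - Y i) + (x - Y j)))\<^sup>2"
      unfolding norm_scaleR by (simp add: power2_eq_square)
    moreover have "norm (x - Y i - (x - Y j)) = norm (Y i - Y j)"
      by (simp add: norm_minus_commute)
    ultimately show ?thesis
      using parallelogram[of "x - Y i" "x - Y j"] Y(2)[of i] Y(2)[of j]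
      by (simp only:)
  qed
  have "Cauchy Y"
  proof (rule metric_CauchyI)
    fix e :: real
    assume "0 < e"
    then obtain N where N: "inverse (Suc N) < e\<^sup>2 / 4"
      using reals_Archimedean[of "e\<^sup>2 / 4"] by auto
    have "dist (Y i) (Y j) < e" if "i \<ge> N" "j \<ge> N" for i j
    proof -
      have "inverse (real (Suc i)) \<le> inverse (real (Suc N))"
        "inverse (real (Suc j)) \<le> inverse (real (Suc N))"
        using that by (auto intro!: le_imp_inverse_le)
      with gap[of i j] N have "(dist (Y i) (Y j))\<^sup>2 < e\<^sup>2"
        unfolding dist_norm by linarith
      with \<open>0 < e\<close> show ?thesis
        by (simp add: power2_less_imp_less)
    qed
    then show "\<exists>N. \<forall>i\<ge>N. \<forall>j\<ge>N. dist (Y i) (Y j) < e" by blast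
  qed
  then obtain m where m: "Y \<longlonglongrightarrow> m"
    using Cauchy_convergent_iff convergent_def by blast
  have "m \<in> M"
    using M(1) Y(1) m by (rule closed_sequentially)
  have "(norm (x - m))\<^sup>2 \<le> D + 0"
  proof (rule LIMSEQ_le)
    show "(\<lambda>n. (norm (x - Y n))\<^sup>2) \<longlonglongrightarrow> (norm (x - m))\<^sup>2"
      by (intro tendsto_intros m)
    show "(\<lambda>n. D + inverse (real (Suc n))) \<longlonglongrightarrow> D + 0"
      by (intro tendsto_intros LIMSEQ_inverse_real_of_nat)
  qed (use Y(2) less_imp_le in blast)
  then have "norm (x - m) \<le> norm (x - y)" if "y \<in> M" for y
    using lower[OF that] by (simp add: power2_le_imp_le[OF order_trans])
  with \<open>m \<in> M\<close> show ?thesis by (rule that)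
qed

text \<open>Take the nearest point \<open>m\<close>. Moving from \<open>m\<close> inside
  \<open>M\<close> cannot shorten the distance, which kills the real part of
  \<open>cinner (x - m) y\<close>; replacing \<open>y\<close> by its multiple by \<open>\<i>\<close>
  kills the imaginary part.\<close>

lemma orthogonal_projection_exists:
  fixes M :: "'a::complex_hilbert_space set"
  assumes "closed M" "subspace M" and scaleC: "\<And>c y. y \<in> M \<Longrightarrow> scaleC c y \<in> M"
  obtains m where "m \<in> M" "x - m \<in> orthogonal_complement M"
proof -
  obtain m where m: "m \<in> M" "\<And>y. y \<in> M \<Longrightarrow> norm (x - m) \<le> norm (x - y)"
    using nearest_point_exists[OF assms(1) subspace_imp_convex[OF assms(2)]]
      subspace_0[OF assms(2)] by blast
  have Re0: "Re (cinner (x - m) y) = 0" if "y \<in> M" for y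
  proof (cases "y = 0")
    case False
    \<comment> \<open>This \<open>t\<close> minimizes the norm of \<open>x - m - t y\<close> over
      the real multiples of \<open>y\<close>.\<close>
    define t where "t = Re (cinner (x - m) y) / (norm y)\<^sup>2"
    have t: "Re (cinner (x - m) y) = t * (norm y)\<^sup>2"
      using False by (simp add: t_def)
    have "m + t *\<^sub>R y \<in> M"
      using assms(2) m(1) that by (simp add: subspace_add subspace_scale)
    then have "norm (x - m) \<le> norm (x - m - t *\<^sub>R y)"
      using m(2)[of "m + t *\<^sub>R y"] by (simp add: diff_diff_eq)
    then have "(norm (x - m))\<^sup>2 \<le> (norm (x - m - t *\<^sub>R y))\<^sup>2"
      by (simp add: power_mono)
    also have "\<dots> = (norm (x - m))\<^sup>2 - t\<^sup>2 * (norm y)\<^sup>2"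
      unfolding norm_diff_sq[of "x - m"] cinner_scaleR_right
      by (simp add: t power2_eq_square)
    finally show ?thesis
      using False t by (simp add: mult_le_0_iff)
  qed simp
  have "cinner (x - m) y = 0" if "y \<in> M" for y
    using Re0[OF that] Re0[OF scaleC[OF that, of \<i>]]
    by (simp add: cinner_scaleC_right complex_eq_iff)
  with m(1) show ?thesis
    by (intro that) (auto simp: orthogonal_complement_def)
qed

text \<open>The representing vector is a multiple of some \<open>w\<close> orthogonal to the kernel
  of \<open>f\<close>, obtained by projecting a vector outside the kernel.\<close>

lemma Riesz_representation:
  fixes f :: "'a::complex_hilbert_space \<Rightarrow> complex"
  assumes f: "bounded_linear f" and fC: "\<And>c x. f (scaleC c x) = c * f x"
  obtains z where "\<And>x. f x = cinner x z"
proof (cases "\<forall>x. f x = 0")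
  case True
  then show ?thesis by (intro that[of 0]) simp
next
  case False
  then obtain u where u: "f u \<noteq> 0" by blast
  interpret bounded_linear f by fact
  define M where "M = {x. f x = 0}"
  have "closed M"
    unfolding M_def by (intro closed_Collect_eq continuous_on continuous_on_const continuous_intros)
  moreover have "subspace M"
    unfolding M_def by (rule linear_subspace_kernel) (rule linear)
  moreover have "scaleC c y \<in> M" if "y \<in> M" for c y
    using that by (simp add: M_def fC)
  ultimately obtain m where m: "m \<in> M" "u - m \<in> orthogonal_complement M"
    by (rule orthogonal_projection_exists)
  define w where "w = u - m"
  have fw: "f w \<noteq> 0"
    using u m(1) by (simp add: w_def M_def diff)
  then have w0: "w \<noteq> 0" using zero by auto
  have "f x = cinner x (scaleC (cnj (f w / cinner w w)) w)" for x
  proof -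
    \<comment> \<open>Removing the multiple of \<open>w\<close> on which \<open>f\<close> takes the
      value \<open>f x\<close> leaves a kernel vector, and \<open>w\<close> is orthogonal to
      it.\<close>
    have "x - scaleC (f x / f w) w \<in> M"
      using fw by (simp add: M_def diff fC)
    then have "cinner w (x - scaleC (f x / f w) w) = 0"
      using m(2) by (simp add: orthogonal_complement_def w_def)
    then have "cinner (x - scaleC (f x / f w) w) w = 0"
      by (metis cinner_commute complex_cnj_zero)
    then have "cinner x w = f x / f w * cinner w w"
      by (simp add: cinner_simps)
    then show ?thesis
      using fw w0 by (simp add: cinner_simps)
  qed
  then show ?thesis by (rule that)
qed


section \<open>Adjoints and positive operators\<close>

text \<open>Riesz representation gives the values of \<open>S\<close> one at a time. Linearity
  follows from nondegeneracy, and boundedness from writing the squared norm of \<open>S y\<close> as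
  the inner product of \<open>T (S y)\<close> with \<open>y\<close>.\<close>

lemma hilbert_adjoint_exists:
  fixes T :: "'a::complex_hilbert_space \<Rightarrow>\<^sub>L 'a"
  assumes T: "complex_linear T"
  shows "\<exists>S. complex_linear S \<and> (\<forall>x y. cinner (T x) y = cinner x (blinfun_apply S y))"
proof -
  have "\<exists>z. \<forall>x. cinner (T x) y = cinner x z" for y
  proof (rule Riesz_representation[of "\<lambda>x. cinner (T x) y"])
    show "bounded_linear (\<lambda>x. cinner (T x) y)"
      by (rule bounded_linear_compose[OF bounded_bilinear.bounded_linear_left
            [OF bounded_bilinear_cinner] blinfun.bounded_linear_right])
    show "cinner (T (scaleC c x)) y = c * cinner (T x) y" for c x
      using T by (simp add: complex_linear_def cinner_scaleC_left)
  qed blast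
  then obtain S where S: "\<And>x y. cinner (T x) y = cinner x (S y)" by metis
  have "bounded_linear S"
  proof (rule bounded_linear_intro)
    show "S (x + y) = S x + S y" for x y
      by (rule cinner_ext_right) (simp add: cinner_add_right flip: S)
    show "S (r *\<^sub>R x) = r *\<^sub>R S x" for r x
      by (rule cinner_ext_right) (simp add: cinner_scaleR_right flip: S)
    show "norm (S y) \<le> norm y * norm T" for y
    proof (cases "S y = 0")
      case False
      have "(norm (S y))\<^sup>2 = Re (cinner (T (S y)) y)"
        by (simp add: S Re_cinner_self)
      also have "\<dots> \<le> norm (T (S y)) * norm y"
        by (rule order_trans[OF complex_Re_le_cmod cinner_Cauchy_Schwarz])
      also have "\<dots> \<le> norm T * norm (S y) * norm y"
        by (intro mult_right_mono norm_blinfun) simp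
      finally show ?thesis
        using False by (simp add: power2_eq_square mult.assoc mult.commute)
    qed simp
  qed
  moreover have "S (scaleC c x) = scaleC c (S x)" for c x
    by (rule cinner_ext_right) (simp add: cinner_scaleC_right flip: S)
  ultimately show ?thesis
    using S by (intro exI[of _ "Blinfun S"]) (simp add: complex_linear_def bounded_linear_Blinfun_apply)
qed

lemma hilbert_adjoint:
  fixes T :: "'a::complex_hilbert_space \<Rightarrow>\<^sub>L 'a"
  assumes "complex_linear T"
  shows complex_linear_hilbert_adjoint: "complex_linear (hilbert_adjoint T)"
    and cinner_hilbert_adjoint: "cinner (T x) y = cinner x (hilbert_adjoint T y)"
proof -
  have "\<exists>!S. complex_linear S \<and> (\<forall>x y. cinner (T x) y = cinner x (blinfun_apply S y))"
    using hilbert_adjoint_exists[OF assms]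
    by (rule ex_ex1I) (metis blinfun_eqI cinner_ext_right)
  from theI'[OF this, folded hilbert_adjoint_def] show "complex_linear (hilbert_adjoint T)"
    "cinner (T x) y = cinner x (hilbert_adjoint T y)"
    by blast+
qed

section \<open>Positive operators: symmetry and norm estimates\<close>

lemma positive_operator_linear: "positive_operator A \<Longrightarrow> complex_linear A"
  by (simp add: positive_operator_def)

lemma positive_operator_cinner:
  assumes "positive_operator A"
  shows Re_cinner_positive: "0 \<le> Re (cinner (A x) x)"
    and Im_cinner_positive: "Im (cinner (A x) x) = 0"
  using assms by (auto simp: positive_operator_def complex_nonneg_Reals_iff)

(* Polarization: only over the complex field does a real quadratic form force symmetry. *)
lemma positive_operator_symmetric:
  assumes "positive_operator A"
  shows "cinner (A x) y = cinner x (A y)"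
proof -
  have AC: "A (scaleC c z) = scaleC c (A z)" for c z
    using assms by (simp add: positive_operator_def complex_linear_def)
  have "Im (cinner (A (x + y)) (x + y)) = 0"
    "Im (cinner (A (x + scaleC \<i> y)) (x + scaleC \<i> y)) = 0"
    by (rule Im_cinner_positive[OF assms])+
  then have "Im (cinner (A x) y) + Im (cinner (A y) x) = 0"
    "Re (cinner (A y) x) - Re (cinner (A x) y) = 0"
    by (simp_all add: blinfun.add_right cinner_simps AC Im_cinner_positive[OF assms])
  then have "cinner (A x) y = cnj (cinner (A y) x)"
    by (simp add: complex_eq_iff)
  then show ?thesis
    by (simp add: cinner_commute[of x])
qed

text \<open>This is A^2 \<le> t A in the sense of forms. It comes from expanding the form of
  \<open>A\<close> at \<open>t *\<^sub>R x - A x\<close>, so it is available before square roots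
  have been constructed.\<close>

lemma norm_positive_operator_sq_le:
  assumes A: "positive_operator A" and t: "norm A \<le> t"
  shows "(norm (A x))\<^sup>2 \<le> t * Re (cinner (A x) x)"
proof (cases "t = 0")
  case True
  with t have "A = 0" by simp
  then show ?thesis by simp
next
  case False
  with t have "0 < t" using norm_ge_zero[of A] by linarith
  have "Re (cinner (A (A x)) (A x)) \<le> norm (A (A x)) * norm (A x)"
    by (rule order_trans[OF complex_Re_le_cmod cinner_Cauchy_Schwarz])
  also have "\<dots> \<le> t * norm (A x) * norm (A x)"
    using norm_blinfun[of A "A x"] mult_right_mono[OF t norm_ge_zero[of "A x"]]
    by (intro mult_right_mono) auto
  finally have 1: "Re (cinner (A (A x)) (A x)) \<le> t * (norm (A x))\<^sup>2"
    by (simp add: power2_eq_square)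
  have 2: "Re (cinner (A (A x)) x) = (norm (A x))\<^sup>2"
    by (simp add: positive_operator_symmetric[OF A, of "A x"] Re_cinner_self)
  have "0 \<le> Re (cinner (A (t *\<^sub>R x - A x)) (t *\<^sub>R x - A x))"
    by (rule Re_cinner_positive[OF A])
  also have "\<dots> = t * (t * Re (cinner (A x) x)) - 2 * (t * (norm (A x))\<^sup>2) + Re (cinner (A (A x)) (A x))"
    by (simp add: blinfun.diff_right blinfun.scaleR_right cinner_simps 2 Re_cinner_self algebra_simps)
  finally have "t * (norm (A x))\<^sup>2 \<le> t * (t * Re (cinner (A x) x))"
    using 1 by simp
  with \<open>0 < t\<close> show ?thesis by simp
qed

(* Vectors that almost attain the bound t are almost eigenvectors for the eigenvalue t. *)
lemma norm_positive_operator_diff_sq_le: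
  assumes A: "positive_operator A" and t: "norm A \<le> t"
  shows "(norm (A x - t *\<^sub>R x))\<^sup>2 \<le> t\<^sup>2 * (norm x)\<^sup>2 - (norm (A x))\<^sup>2"
  using norm_positive_operator_sq_le[OF A t, of x]
  by (simp add: norm_diff_sq cinner_simps power_mult_distrib)

lemma positive_operator_eq_zero:
  assumes "positive_operator A" "Re (cinner (A x) x) = 0"
  shows "A x = 0"
  using norm_positive_operator_sq_le[OF assms(1) order_refl, of x] assms(2) by simp


section \<open>Square roots of positive operators\<close>

fun sqrt_iter :: "('a::real_normed_vector \<Rightarrow>\<^sub>L 'a) \<Rightarrow> nat \<Rightarrow> ('a \<Rightarrow>\<^sub>L 'a)" where
  "sqrt_iter B 0 = 0"
| "sqrt_iter B (Suc n) = (1/2) *\<^sub>R (B + (sqrt_iter B n o\<^sub>L sqrt_iter B n))"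

fun scalar_sqrt_iter :: "nat \<Rightarrow> real" where
  "scalar_sqrt_iter 0 = 0"
| "scalar_sqrt_iter (Suc n) = (1 + (scalar_sqrt_iter n)\<^sup>2) / 2"

lemma scalar_sqrt_iter_bounds: "0 \<le> scalar_sqrt_iter n \<and> scalar_sqrt_iter n \<le> 1"
proof (induction n)
  case (Suc n)
  then have "(scalar_sqrt_iter n)\<^sup>2 \<le> 1" by (simp add: power_le_one)
  then show ?case by simp
qed simp

text \<open>The increment from s is (1 - s)^2 / 2.\<close>

lemma scalar_sqrt_iter_mono: "scalar_sqrt_iter n \<le> scalar_sqrt_iter (Suc n)"
proof -
  have "0 \<le> (1 - scalar_sqrt_iter n)\<^sup>2" by simp
  then show ?thesis by (simp add: power2_eq_square algebra_simps)
qed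

lemma norm_sqrt_iter_le:
  assumes "norm B \<le> 1"
  shows "norm (sqrt_iter B n) \<le> scalar_sqrt_iter n"
proof (induction n)
  case (Suc n)
  have "norm (B + (sqrt_iter B n o\<^sub>L sqrt_iter B n))
      \<le> norm B + norm (sqrt_iter B n) * norm (sqrt_iter B n)"
    by (intro norm_triangle_le add_left_mono norm_blinfun_compose)
  also have "\<dots> \<le> 1 + scalar_sqrt_iter n * scalar_sqrt_iter n"
    using Suc scalar_sqrt_iter_bounds[of n] assms by (intro add_mono mult_mono) auto
  finally show ?case by (simp add: power2_eq_square)
qed simp

text \<open>Induction through Y^2 - X^2 = Y (Y - X) + (Y - X) X, which holds for noncommuting
  operators as well. The scalar increments obey the same recursion with equality.\<close>

lemma norm_sqrt_iter_diff_le: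
  assumes B: "norm B \<le> 1"
  shows "norm (sqrt_iter B (Suc n) - sqrt_iter B n) \<le> scalar_sqrt_iter (Suc n) - scalar_sqrt_iter n"
proof (induction n)
  case 0
  then show ?case using B by simp
next
  case (Suc n)
  define X Y where "X = sqrt_iter B n" and "Y = sqrt_iter B (Suc n)"
  define p q where "p = scalar_sqrt_iter n" and "q = scalar_sqrt_iter (Suc n)"
  have XY: "norm X \<le> p" "norm Y \<le> q" "norm (Y - X) \<le> q - p" "0 \<le> p" "0 \<le> q"
    unfolding X_def Y_def p_def q_def using Suc norm_sqrt_iter_le[OF B] scalar_sqrt_iter_bounds
    by blast+
  have "sqrt_iter B (Suc (Suc n)) = (1/2) *\<^sub>R (B + (Y o\<^sub>L Y))"
    unfolding Y_def by (rule sqrt_iter.simps)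
  moreover have "sqrt_iter B (Suc n) = (1/2) *\<^sub>R (B + (X o\<^sub>L X))"
    unfolding X_def by (rule sqrt_iter.simps)
  ultimately have "sqrt_iter B (Suc (Suc n)) - sqrt_iter B (Suc n)
      = (1/2) *\<^sub>R ((Y o\<^sub>L (Y - X)) + ((Y - X) o\<^sub>L X))"
    by (auto intro!: blinfun_eqI simp: blinfun.bilinear_simps algebra_simps simp del: sqrt_iter.simps)
  moreover have "p \<le> q"
    using XY(3) norm_ge_zero[of "Y - X"] by linarith
  then have "norm ((Y o\<^sub>L (Y - X)) + ((Y - X) o\<^sub>L X)) \<le> q * (q - p) + (q - p) * p"
    using XY by (intro norm_triangle_mono order_trans[OF norm_blinfun_compose] mult_mono) auto
  moreover have "scalar_sqrt_iter (Suc (Suc n)) - scalar_sqrt_iter (Suc n) = (1/2) * (q * (q - p) + (q - p) * p)"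
    unfolding p_def q_def scalar_sqrt_iter.simps(2)[of "Suc n"]
    by (simp add: power2_eq_square field_simps)
  ultimately show ?case by simp
qed

text \<open>The scalar iterates are increasing and bounded, so their increments are summable. They
  dominate the operator increments, whose telescoping series therefore converges in operator
  norm.\<close>

lemma convergent_sqrt_iter:
  fixes B :: "'a::banach \<Rightarrow>\<^sub>L 'a"
  assumes B: "norm B \<le> 1"
  shows "convergent (sqrt_iter B)"
proof -
  have "incseq scalar_sqrt_iter"
    by (rule incseq_SucI) (rule scalar_sqrt_iter_mono)
  then have "convergent scalar_sqrt_iter"
    using incseq_convergent[of scalar_sqrt_iter 1] scalar_sqrt_iter_bounds
    by (metis convergent_def)
  then have "summable (\<lambda>n. scalar_sqrt_iter (Suc n) - scalar_sqrt_iter n)"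
    by (metis telescope_summable convergent_def)
  then have "summable (\<lambda>n. sqrt_iter B (Suc n) - sqrt_iter B n)"
    by (rule summable_comparison_test') (rule norm_sqrt_iter_diff_le[OF B])
  then show ?thesis
    by (simp add: summable_iff_convergent sum_lessThan_telescope del: sqrt_iter.simps(2))
qed

lemma tendsto_blinfun_compose [tendsto_intros]:
  "(f \<longlongrightarrow> a) F \<Longrightarrow> (g \<longlongrightarrow> b) F \<Longrightarrow> ((\<lambda>x. f x o\<^sub>L g x) \<longlongrightarrow> a o\<^sub>L b) F"
  by (rule bounded_bilinear.tendsto[OF bounded_bilinear_blinfun_compose])

lemma complex_linear_sqrt_iter: "complex_linear B \<Longrightarrow> complex_linear (sqrt_iter B n)"
  by (induction n) (auto simp: complex_linear_def blinfun.bilinear_simps scaleC_add_right scaleC_scaleR)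

text \<open>Each iterate is a polynomial in \<open>B\<close>. In the limit this becomes the
  commutation clause on which uniqueness of the square root rests.\<close>

lemma sqrt_iter_commute:
  assumes "C o\<^sub>L B = B o\<^sub>L C"
  shows "C o\<^sub>L sqrt_iter B n = sqrt_iter B n o\<^sub>L C"
proof (induction n)
  case (Suc n)
  have 1: "C (B x) = B (C x)" "C (sqrt_iter B n x) = sqrt_iter B n (C x)" for x
    using assms Suc by (metis blinfun_apply_blinfun_compose)+
  show ?case
    by (rule blinfun_eqI) (simp add: blinfun.bilinear_simps 1)
qed simp

text \<open>The root is 1 - Y with Y the limit of the iteration for 1 - A. The commutation clause is
  carried along because it forces every other positive root to commute with this one.\<close>

lemma contraction_sqrt_exists:
  fixes A :: "'a::complex_hilbert_space \<Rightarrow>\<^sub>L 'a"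
  assumes A: "complex_linear A" "norm (id_blinfun - A) \<le> 1"
    and sym: "\<And>x y. cinner (A x) y = cinner x (A y)"
  shows "\<exists>R. positive_operator R \<and> R o\<^sub>L R = A \<and> (\<forall>C. C o\<^sub>L A = A o\<^sub>L C \<longrightarrow> C o\<^sub>L R = R o\<^sub>L C)"
proof -
  define B where "B = id_blinfun - A"
  define Y where "Y = lim (sqrt_iter B)"
  have Y: "sqrt_iter B \<longlonglongrightarrow> Y"
    using convergent_sqrt_iter[of B] A(2) by (simp add: B_def Y_def convergent_LIMSEQ_iff)
  have Yx: "(\<lambda>n. sqrt_iter B n x) \<longlonglongrightarrow> Y x" for x
    by (intro tendsto_intros Y)
  have "(\<lambda>n. sqrt_iter B (Suc n)) \<longlonglongrightarrow> (1/2) *\<^sub>R (B + (Y o\<^sub>L Y))"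
    unfolding sqrt_iter.simps by (intro tendsto_intros Y)
  then have fix_pt: "Y = (1/2) *\<^sub>R (B + (Y o\<^sub>L Y))"
    using LIMSEQ_Suc[OF Y] LIMSEQ_unique by blast
  have BL: "complex_linear B"
    using A(1) by (simp add: complex_linear_def B_def blinfun.bilinear_simps scaleC_diff_right)
  have YC: "Y (scaleC c x) = scaleC c (Y x)" for c x
  proof (rule LIMSEQ_unique[OF Yx])
    show "(\<lambda>n. sqrt_iter B n (scaleC c x)) \<longlonglongrightarrow> scaleC c (Y x)"
      using complex_linear_sqrt_iter[OF BL] tendsto_scaleC[OF Yx] by (simp add: complex_linear_def)
  qed
  have symB: "cinner (sqrt_iter B n x) y = cinner x (sqrt_iter B n y)" for n x y
  proof (induction n arbitrary: x y)
    case (Suc n)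
    then show ?case by (simp add: blinfun.bilinear_simps cinner_simps B_def sym)
  qed simp
  have symY: "cinner (Y x) y = cinner x (Y y)" for x y
  proof (rule LIMSEQ_unique)
    show "(\<lambda>n. cinner (sqrt_iter B n x) y) \<longlonglongrightarrow> cinner (Y x) y"
      by (intro tendsto_intros Yx)
    show "(\<lambda>n. cinner (sqrt_iter B n x) y) \<longlonglongrightarrow> cinner x (Y y)"
      unfolding symB by (intro tendsto_intros Yx)
  qed
  have "norm (sqrt_iter B n) \<le> 1" for n
    using norm_sqrt_iter_le[of B n] A(2) scalar_sqrt_iter_bounds[of n] by (simp add: B_def)
  then have normY: "norm Y \<le> 1"
    using LIMSEQ_le_const2[OF tendsto_norm[OF Y]] by blast
  define R where "R = id_blinfun - Y"
  have "positive_operator R"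
    unfolding positive_operator_def complex_linear_def
  proof (intro conjI allI)
    show "R (scaleC c x) = scaleC c (R x)" for c x
      by (simp add: R_def blinfun.bilinear_simps YC scaleC_diff_right)
    fix x
    have "Re (cinner (Y x) x) \<le> norm (Y x) * norm x"
      by (rule order_trans[OF complex_Re_le_cmod cinner_Cauchy_Schwarz])
    also have "\<dots> \<le> 1 * norm x * norm x"
      using norm_blinfun[of Y x] mult_right_mono[OF normY norm_ge_zero[of x]]
      by (intro mult_right_mono) auto
    finally have "0 \<le> Re (cinner (R x) x)"
      by (simp add: R_def blinfun.bilinear_simps cinner_simps Re_cinner_self power2_eq_square)
    moreover have "cinner (Y x) x = cnj (cinner (Y x) x)"
      using symY[of x x] cinner_commute[of x "Y x"] by simp
    then have "Im (cinner (R x) x) = 0"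
      by (simp add: R_def blinfun.bilinear_simps cinner_simps cinner_self complex_eq_iff)
    ultimately show "cinner (R x) x \<in> \<real>\<^sub>\<ge>\<^sub>0"
      by (simp add: complex_nonneg_Reals_iff)
  qed
  moreover have "R o\<^sub>L R = A"
  proof (rule blinfun_eqI)
    fix x
    \<comment> \<open>The fixed point equation gives (1 - Y)^2 = 1 - 2 Y + Y^2 = 1 - B = A.\<close>
    have "2 *\<^sub>R Y = B + (Y o\<^sub>L Y)"
      using arg_cong[OF fix_pt, of "scaleR 2"] unfolding scaleR_scaleR by simp
    from arg_cong[OF this, of "\<lambda>F. F x"] have "2 *\<^sub>R Y x = B x + Y (Y x)"
      by (simp add: blinfun.bilinear_simps)
    then show "(R o\<^sub>L R) x = A x"
      by (simp add: R_def B_def blinfun.bilinear_simps scaleR_2 algebra_simps)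
  qed
  moreover have "C o\<^sub>L R = R o\<^sub>L C" if C: "C o\<^sub>L A = A o\<^sub>L C" for C
  proof -
    have CA: "C (A x) = A (C x)" for x
      using C by (metis blinfun_apply_blinfun_compose)
    have "C o\<^sub>L B = B o\<^sub>L C"
      by (rule blinfun_eqI) (simp add: B_def blinfun.bilinear_simps CA)
    note comm = sqrt_iter_commute[OF this]
    have "C o\<^sub>L Y = Y o\<^sub>L C"
    proof (rule LIMSEQ_unique)
      show "(\<lambda>n. C o\<^sub>L sqrt_iter B n) \<longlonglongrightarrow> (C o\<^sub>L Y)"
        by (intro tendsto_intros Y)
      show "(\<lambda>n. C o\<^sub>L sqrt_iter B n) \<longlonglongrightarrow> (Y o\<^sub>L C)"
        unfolding comm by (intro tendsto_intros Y)
    qed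
    then have CY: "C (Y x) = Y (C x)" for x
      by (metis blinfun_apply_blinfun_compose)
    show ?thesis
      by (rule blinfun_eqI) (simp add: R_def blinfun.bilinear_simps CY)
  qed
  ultimately show ?thesis by blast
qed

section \<open>Existence and uniqueness of the positive square root\<close>

lemma positive_operator_scaleR:
  assumes "positive_operator A" "0 \<le> r"
  shows "positive_operator (r *\<^sub>R A)"
  using assms by (auto simp: positive_operator_def complex_linear_def blinfun.bilinear_simps
      scaleC_scaleR cinner_simps complex_nonneg_Reals_iff)

text \<open>Dividing by the norm reduces to the contraction case; the root found there is multiplied
  by \<open>sqrt a\<close>.\<close>

lemma positive_sqrt_exists:
  fixes A :: "'a::complex_hilbert_space \<Rightarrow>\<^sub>L 'a"
  assumes A: "positive_operator A"
  shows "\<exists>R. positive_operator R \<and> R o\<^sub>L R = A \<and> (\<forall>C. C o\<^sub>L A = A o\<^sub>L C \<longrightarrow> C o\<^sub>L R = R o\<^sub>L C)"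
proof (cases "A = 0")
  case True
  then show ?thesis by (intro exI[of _ 0]) (use A in auto)
next
  case False
  define a where "a = norm A"
  define A' where "A' = (1 / a) *\<^sub>R A"
  have a: "a > 0" using False by (simp add: a_def)
  have pos: "positive_operator A'"
    unfolding A'_def using A a by (intro positive_operator_scaleR) auto
  have norm1: "norm A' \<le> 1" using a by (simp add: A'_def a_def)
  have "norm (id_blinfun - A') \<le> 1"
  proof (rule norm_blinfun_bound)
    fix x
    \<comment> \<open>The almost-eigenvector estimate at t = 1, with the square of
      \<open>norm (A' x)\<close> then dropped, makes 1 - A' a contraction.\<close>
    have "(norm (A' x - 1 *\<^sub>R x))\<^sup>2 \<le> 1\<^sup>2 * (norm x)\<^sup>2 - (norm (A' x))\<^sup>2"
      by (rule norm_positive_operator_diff_sq_le[OF pos norm1])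
    then have "(norm (A' x - x))\<^sup>2 \<le> (norm x)\<^sup>2"
      using zero_le_power2[of "norm (A' x)"] unfolding scaleR_one power_one mult_1_left by linarith
    then have "norm (A' x - x) \<le> norm x"
      by (rule power2_le_imp_le) simp
    then show "norm ((id_blinfun - A') x) \<le> 1 * norm x"
      by (simp add: blinfun.bilinear_simps norm_minus_commute)
  qed simp
  then obtain R where R: "positive_operator R" "R o\<^sub>L R = A'"
    "\<And>C. C o\<^sub>L A' = A' o\<^sub>L C \<Longrightarrow> C o\<^sub>L R = R o\<^sub>L C"
    using contraction_sqrt_exists[of A'] positive_operator_linear[OF pos]
      positive_operator_symmetric[OF pos] by blast
  have compR: "c *\<^sub>R F o\<^sub>L G = c *\<^sub>R (F o\<^sub>L G)" "F o\<^sub>L c *\<^sub>R G = c *\<^sub>R (F o\<^sub>L G)"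
    for c and F G :: "'a \<Rightarrow>\<^sub>L 'a"
    by (rule blinfun_eqI, simp add: blinfun.bilinear_simps)+
  have "positive_operator (sqrt a *\<^sub>R R)"
    using R(1) a by (intro positive_operator_scaleR) auto
  moreover have "sqrt a *\<^sub>R R o\<^sub>L sqrt a *\<^sub>R R = A"
    using a by (simp add: compR R(2)) (simp add: A'_def)
  moreover have "C o\<^sub>L sqrt a *\<^sub>R R = sqrt a *\<^sub>R R o\<^sub>L C" if "C o\<^sub>L A = A o\<^sub>L C" for C
    using R(3)[of C] that by (simp add: compR A'_def)
  ultimately show ?thesis by blast
qed

text \<open>For y = (R - S) x, commutation gives (R + S) y = (R^2 - S^2) x = 0. Both nonnegative
  forms then vanish at y, so R y = S y = 0, and symmetry gives that the squared norm of y equals the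
  inner product of x with (R - S) y, which is 0.\<close>

lemma positive_sqrt_unique:
  fixes R S :: "'a::complex_hilbert_space \<Rightarrow>\<^sub>L 'a"
  assumes R: "positive_operator R" and S: "positive_operator S"
    and sq: "R o\<^sub>L R = S o\<^sub>L S" and comm: "R o\<^sub>L S = S o\<^sub>L R"
  shows "R = S"
proof (rule blinfun_eqI)
  fix x
  define y where "y = R x - S x"
  have sq': "R (R z) = S (S z)" and comm': "R (S z) = S (R z)" for z
    using sq comm by (metis blinfun_apply_blinfun_compose)+
  have "R y + S y = 0"
    by (simp add: y_def blinfun.bilinear_simps sq' comm')
  then have "Re (cinner (R y + S y) y) = 0" by simp
  then have "Re (cinner (R y) y) + Re (cinner (S y) y) = 0"
    by (simp add: cinner_simps)
  with Re_cinner_positive[OF R, of y] Re_cinner_positive[OF S, of y]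
  have "R y = 0" "S y = 0"
    using positive_operator_eq_zero R S by (metis add_nonneg_eq_0_iff)+
  then have "cinner y y = 0"
    by (simp add: y_def cinner_diff_left positive_operator_symmetric[OF R]
        positive_operator_symmetric[OF S])
  then show "R x = S x"
    by (simp add: y_def)
qed

lemma operator_sqrt:
  fixes A :: "'a::complex_hilbert_space \<Rightarrow>\<^sub>L 'a"
  assumes "positive_operator A"
  shows positive_operator_sqrt: "positive_operator (operator_sqrt A)"
    and operator_sqrt_square: "operator_sqrt A o\<^sub>L operator_sqrt A = A"
proof -
  obtain R where R: "positive_operator R" "R o\<^sub>L R = A"
    "\<And>C. C o\<^sub>L A = A o\<^sub>L C \<Longrightarrow> C o\<^sub>L R = R o\<^sub>L C"
    using positive_sqrt_exists[OF assms] by blast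
  have "S = R" if "positive_operator S" "S o\<^sub>L S = A" for S
  proof (rule positive_sqrt_unique)
    \<comment> \<open>A positive root commutes with its own square \<open>A\<close>, hence with the
      constructed root \<open>R\<close>.\<close>
    have "S o\<^sub>L A = A o\<^sub>L S"
      unfolding that(2)[symmetric] by (rule blinfun_eqI) simp
    then show "S o\<^sub>L R = R o\<^sub>L S" by (rule R(3))
  qed (simp_all only: that R)
  with R(1,2) have "\<exists>!B. positive_operator B \<and> B o\<^sub>L B = A" by blast
  from theI'[OF this, folded operator_sqrt_def] show "positive_operator (operator_sqrt A)"
    "operator_sqrt A o\<^sub>L operator_sqrt A = A"
    by blast+
qed


section \<open>Polar decomposition\<close>

text \<open>Both squared norms are the form of T^* T at \<open>x\<close>. Later arguments about
  \<open>operator_abs T\<close> rely only on its positivity and this equality of norms.\<close>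

lemma operator_abs:
  fixes T :: "'a::complex_hilbert_space \<Rightarrow>\<^sub>L 'a"
  assumes T: "complex_linear T"
  shows positive_operator_abs: "positive_operator (operator_abs T)"
    and norm_operator_abs_apply: "norm (operator_abs T x) = norm (T x)"
proof -
  have adj: "cinner (hilbert_adjoint T y) x = cinner y (T x)" for x y
    using cinner_hilbert_adjoint[OF T] by (metis cinner_commute)
  have "positive_operator (hilbert_adjoint T o\<^sub>L T)"
    using T complex_linear_hilbert_adjoint[OF T]
    by (auto simp: positive_operator_def complex_linear_def adj cinner_self complex_nonneg_Reals_iff)
  then have A: "positive_operator (operator_abs T)"
    "operator_abs T o\<^sub>L operator_abs T = hilbert_adjoint T o\<^sub>L T"
    unfolding operator_abs_def by (rule operator_sqrt)+
  show "positive_operator (operator_abs T)" by (rule A)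
  have "cinner (operator_abs T x) (operator_abs T x) = cinner ((operator_abs T o\<^sub>L operator_abs T) x) x"
    by (simp add: positive_operator_symmetric[OF A(1)])
  also have "\<dots> = cinner (T x) (T x)"
    by (simp add: A(2) adj)
  finally show "norm (operator_abs T x) = norm (T x)"
    by (simp add: cinner_self flip: of_real_power)
qed

section \<open>Splitting along the closed range and the kernel\<close>

lemma subspace_closure:
  fixes S :: "'a::real_normed_vector set"
  assumes S: "subspace S"
  shows "subspace (closure S)"
  unfolding subspace_def
proof (intro conjI ballI allI)
  show "0 \<in> closure S"
    using subspace_0[OF S] closure_subset by blast
  show "x + y \<in> closure S" if xy: "x \<in> closure S" "y \<in> closure S" for x y
  proof -
    obtain f g where "\<And>n. f n \<in> S" "f \<longlonglongrightarrow> x" "\<And>n. g n \<in> S" "g \<longlonglongrightarrow> y"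
      using xy unfolding closure_sequential by blast
    then show ?thesis
      unfolding closure_sequential
      by (intro exI[of _ "\<lambda>n. f n + g n"]) (auto intro: tendsto_add subspace_add[OF S])
  qed
  show "c *\<^sub>R x \<in> closure S" if "x \<in> closure S" for c x
  proof -
    obtain f where "\<And>n. f n \<in> S" "f \<longlonglongrightarrow> x"
      using \<open>x \<in> closure S\<close> unfolding closure_sequential by blast
    then show ?thesis
      unfolding closure_sequential
      by (intro exI[of _ "\<lambda>n. c *\<^sub>R f n"]) (auto intro: tendsto_intros subspace_scale[OF S])
  qed
qed

text \<open>\<open>m\<close> is the projection of \<open>z\<close> to the closure of the range. The
  rest z - m is orthogonal to A (A (z - m)), and symmetry turns this into A (z - m) = 0.\<close>

lemma positive_operator_decomposition:
  fixes A :: "'a::complex_hilbert_space \<Rightarrow>\<^sub>L 'a"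
  assumes A: "positive_operator A"
  obtains X m where "(\<lambda>n::nat. A (X n)) \<longlonglongrightarrow> m" "A (z - m) = 0"
proof -
  have AC: "A (scaleC c x) = scaleC c (A x)" for c x
    using positive_operator_linear[OF A] by (simp add: complex_linear_def)
  define M where "M = closure (range (blinfun_apply A))"
  have "subspace (range (blinfun_apply A))"
    by (intro linear_subspace_image bounded_linear.linear blinfun.bounded_linear_right subspace_UNIV)
  then have "subspace M"
    unfolding M_def by (rule subspace_closure)
  moreover have "closed M" by (simp add: M_def)
  moreover have "scaleC c y \<in> M" if y: "y \<in> M" for c y
  proof -
    have "scaleC c ` M \<subseteq> closure (scaleC c ` range A)"
      unfolding M_def by (rule closure_bounded_linear_image_subset[OF bounded_linear_scaleC])
    also have "\<dots> \<subseteq> M"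
      unfolding M_def by (intro closure_mono) (auto simp flip: AC)
    finally show ?thesis using y by blast
  qed
  ultimately obtain m where m: "m \<in> M" "z - m \<in> orthogonal_complement M"
    using orthogonal_projection_exists by blast
  obtain f where f: "\<And>n. f n \<in> range A" "f \<longlonglongrightarrow> m"
    using m(1) unfolding M_def closure_sequential by blast
  have "\<exists>x. f n = A x" for n
    using f(1) by blast
  then obtain X where X: "\<And>n. f n = A (X n)" by metis
  have "A (A (z - m)) \<in> M"
    unfolding M_def by (rule closure_subset[THEN subsetD]) simp
  then have "cinner (z - m) (A (A (z - m))) = 0"
    using m(2) by (auto simp: orthogonal_complement_def)
  then have "cinner (A (z - m)) (A (z - m)) = 0"
    by (simp add: positive_operator_symmetric[OF A])
  then have "A (z - m) = 0" by simp
  with f(2) show ?thesis by (intro that) (simp_all add: X[abs_def])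
qed

lemma orthogonal_range_kernel:
  assumes A: "positive_operator A" and m: "(\<lambda>n::nat. A (X n)) \<longlonglongrightarrow> m" and k: "A k = 0"
  shows "cinner m k = 0"
proof (rule LIMSEQ_unique)
  show "(\<lambda>n. cinner (A (X n)) k) \<longlonglongrightarrow> cinner m k"
    by (intro tendsto_intros m)
  show "(\<lambda>n. cinner (A (X n)) k) \<longlonglongrightarrow> 0"
    by (simp add: positive_operator_symmetric[OF A] k)
qed

(* polar_graph A T z w says w = U z for the polar isometry U: with m the projection of z to
   the closure of the range of A, the pair (m, w) lies in the closure of {(A x, T x)}. *)
definition polar_graph ::
  "('a::real_normed_vector \<Rightarrow>\<^sub>L 'a) \<Rightarrow> ('a \<Rightarrow>\<^sub>L 'a) \<Rightarrow> 'a \<Rightarrow> 'a \<Rightarrow> bool"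
  where "polar_graph A T z w \<longleftrightarrow> (\<exists>X m. (\<lambda>n::nat. A (X n)) \<longlonglongrightarrow> m \<and>
    (\<lambda>n. T (X n)) \<longlonglongrightarrow> w \<and> A (z - m) = 0)"

text \<open>\<open>A\<close> and \<open>T\<close> give differences of arguments equal norms, so
  convergence of \<open>A (X n)\<close> makes \<open>T (X n)\<close> Cauchy.\<close>

lemma polar_graph_exists:
  fixes A T :: "'a::complex_hilbert_space \<Rightarrow>\<^sub>L 'a"
  assumes A: "positive_operator A" and AT: "\<And>x. norm (A x) = norm (T x)"
  shows "\<exists>w. polar_graph A T z w"
proof -
  obtain X m where X: "(\<lambda>n::nat. A (X n)) \<longlonglongrightarrow> m" "A (z - m) = 0"
    using positive_operator_decomposition[OF A] by blast
  have "Cauchy (\<lambda>n. A (X n))"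
    using X(1) by (rule LIMSEQ_imp_Cauchy)
  moreover have "dist (T (X i)) (T (X j)) = dist (A (X i)) (A (X j))" for i j
    using AT[of "X i - X j"] by (simp add: dist_norm blinfun.diff_right)
  ultimately have "Cauchy (\<lambda>n. T (X n))"
    by (simp add: Cauchy_def)
  then obtain w where "(\<lambda>n. T (X n)) \<longlonglongrightarrow> w"
    using Cauchy_convergent_iff convergent_def by blast
  with X show ?thesis by (auto simp: polar_graph_def)
qed

text \<open>Differences reduce uniqueness of the image of \<open>z\<close> to the norm bound at
  0.\<close>

lemma polar_graph_diff:
  assumes "polar_graph A T z w" "polar_graph A T z' w'"
  shows "polar_graph A T (z - z') (w - w')"
proof -
  obtain X m X' m' where X: "(\<lambda>n::nat. A (X n)) \<longlonglongrightarrow> m" "(\<lambda>n. T (X n)) \<longlonglongrightarrow> w" "A (z - m) = 0"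
    "(\<lambda>n. A (X' n)) \<longlonglongrightarrow> m'" "(\<lambda>n. T (X' n)) \<longlonglongrightarrow> w'" "A (z' - m') = 0"
    using assms unfolding polar_graph_def by blast
  show ?thesis
    unfolding polar_graph_def
  proof (intro exI conjI)
    show "(\<lambda>n. A (X n - X' n)) \<longlonglongrightarrow> m - m'" "(\<lambda>n. T (X n - X' n)) \<longlonglongrightarrow> w - w'"
      unfolding blinfun.diff_right by (intro tendsto_diff X)+
    show "A (z - z' - (m - m')) = 0"
      using X(3,6) by (simp add: blinfun.diff_right)
  qed
qed

lemma polar_graph_scaleC:
  assumes A: "complex_linear A" and T: "complex_linear T" and zw: "polar_graph A T z w"
  shows "polar_graph A T (scaleC c z) (scaleC c w)"
proof -
  obtain X m where X: "(\<lambda>n::nat. A (X n)) \<longlonglongrightarrow> m" "(\<lambda>n. T (X n)) \<longlonglongrightarrow> w" "A (z - m) = 0"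
    using zw unfolding polar_graph_def by blast
  have C: "A (scaleC c x) = scaleC c (A x)" "T (scaleC c x) = scaleC c (T x)" for x
    using A T by (simp_all add: complex_linear_def)
  show ?thesis
    unfolding polar_graph_def
  proof (intro exI conjI)
    show "(\<lambda>n. A (scaleC c (X n))) \<longlonglongrightarrow> scaleC c m" "(\<lambda>n. T (scaleC c (X n))) \<longlonglongrightarrow> scaleC c w"
      unfolding C by (intro tendsto_scaleC X)+
    show "A (scaleC c z - scaleC c m) = 0"
      using X(3) by (simp add: C flip: scaleC_diff_right)
  qed
qed

text \<open>In the limit \<open>w\<close> and \<open>m\<close> have equal norm, and \<open>m\<close>
  is orthogonal to the kernel vector z - m. So Pythagoras gives the bound, \<open>m\<close> equals
  \<open>z\<close> when \<open>z\<close> is orthogonal to the kernel, and \<open>m\<close> vanishes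
  exactly when A z = A m does.\<close>

lemma polar_graph_norm:
  fixes A T :: "'a::complex_hilbert_space \<Rightarrow>\<^sub>L 'a"
  assumes A: "positive_operator A" and AT: "\<And>x. norm (A x) = norm (T x)"
    and zw: "polar_graph A T z w"
  shows polar_graph_norm_le: "norm w \<le> norm z"
    and polar_graph_norm_eq: "(\<And>k. A k = 0 \<Longrightarrow> cinner z k = 0) \<Longrightarrow> norm w = norm z"
    and polar_graph_kernel: "w = 0 \<longleftrightarrow> A z = 0"
proof -
  obtain X m where X: "(\<lambda>n::nat. A (X n)) \<longlonglongrightarrow> m" "(\<lambda>n. T (X n)) \<longlonglongrightarrow> w" "A (z - m) = 0"
    using zw unfolding polar_graph_def by blast
  have wm: "norm w = norm m"
  proof (rule LIMSEQ_unique)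
    show "(\<lambda>n. norm (T (X n))) \<longlonglongrightarrow> norm w"
      by (intro tendsto_norm X)
    show "(\<lambda>n. norm (T (X n))) \<longlonglongrightarrow> norm m"
      unfolding AT[symmetric] by (intro tendsto_norm X)
  qed
  have mk: "cinner m k = 0" if "A k = 0" for k
    using orthogonal_range_kernel[OF A X(1) that] .
  have "(norm (z - m))\<^sup>2 = (norm z)\<^sup>2 - (norm m)\<^sup>2"
    using norm_diff_sq[of z m] mk[OF X(3)] Re_cinner_commute[of z m] Re_cinner_self[of m]
    by (simp add: cinner_diff_right complex_eq_iff)
  then have "(norm m)\<^sup>2 \<le> (norm z)\<^sup>2"
    using zero_le_power2[of "norm (z - m)"] by linarith
  then show "norm w \<le> norm z"
    unfolding wm by (rule power2_le_imp_le) simp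
  show "norm w = norm z" if "\<And>k. A k = 0 \<Longrightarrow> cinner z k = 0"
  proof -
    have "cinner (z - m) (z - m) = 0"
      using that[OF X(3)] mk[OF X(3)] by (simp only: cinner_diff_left[of z m]) simp
    then show ?thesis by (simp add: wm)
  qed
  show "w = 0 \<longleftrightarrow> A z = 0"
  proof
    assume "w = 0"
    with wm X(3) show "A z = 0" by simp
  next
    assume "A z = 0"
    with X(3) have "A m = 0" by (simp add: blinfun.diff_right)
    then have "m = 0" using mk[of m] by simp
    with wm show "w = 0" by simp
  qed
qed

text \<open>The relation \<open>polar_graph\<close> is single-valued and everywhere defined, so it
  is the graph of a function, which is linear and contractive by the preceding lemmas.\<close>

lemma polar_isometry_exists:
  fixes T :: "'a::complex_hilbert_space \<Rightarrow>\<^sub>L 'a"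
  assumes T: "complex_linear T" and A: "positive_operator A"
    and AT: "\<And>x. norm (A x) = norm (T x)"
  shows "\<exists>U. partial_isometry U \<and> operator_kernel U = operator_kernel T \<and> T = U o\<^sub>L A \<and> norm U \<le> 1"
proof -
  note norm_le = polar_graph_norm_le[where A = A and T = T, OF A AT]
  have unique: "w = w'" if "polar_graph A T z w" "polar_graph A T z w'" for z w w'
    using norm_le[OF polar_graph_diff[OF that]] by simp
  obtain f where f: "\<And>z. polar_graph A T z (f z)"
    using polar_graph_exists[where A = A and T = T, OF A AT] by metis
  have f_eq: "f z = w" if "polar_graph A T z w" for z w
    using unique f that by blast
  have fC: "f (scaleC c z) = scaleC c (f z)" for c z
    by (intro f_eq polar_graph_scaleC positive_operator_linear A T f)
  have "bounded_linear f"
  proof (rule bounded_linear_intro)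
    have f0: "f 0 = 0" using fC[of 0 0] norm_le[OF f, of 0] by simp
    have fd: "f (x - y) = f x - f y" for x y
      by (intro f_eq polar_graph_diff f)
    show "f (x + y) = f x + f y" for x y
      using fd[of x "0 - y"] fd[of 0 y] f0 by simp
    show "f (r *\<^sub>R x) = r *\<^sub>R f x" for r x
      using fC[of "of_real r" x] by (simp add: scaleC_of_real)
    show "norm (f x) \<le> norm x * 1" for x
      using norm_le[OF f] by simp
  qed
  then have Uf: "blinfun_apply (Blinfun f) = f"
    by (rule bounded_linear_Blinfun_apply)
  have A0: "A x = 0 \<longleftrightarrow> T x = 0" for x
    using AT[of x] by (metis norm_eq_zero)
  have kernel: "operator_kernel (Blinfun f) = operator_kernel T"
    using polar_graph_kernel[where A = A and T = T, OF A AT f] by (simp add: operator_kernel_def Uf A0)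
  moreover have "partial_isometry (Blinfun f)"
    unfolding partial_isometry_def complex_linear_def
  proof (intro conjI allI ballI)
    fix z assume z: "z \<in> orthogonal_complement (operator_kernel (Blinfun f))"
    have "cinner z k = 0" if "A k = 0" for k
    proof -
      have "k \<in> operator_kernel (Blinfun f)"
        using that unfolding kernel by (simp add: operator_kernel_def A0)
      with z show ?thesis by (simp add: orthogonal_complement_def)
    qed
    then show "norm (Blinfun f z) = norm z"
      unfolding Uf using polar_graph_norm_eq[where A = A and T = T, OF A AT f] by blast
  qed (simp add: Uf fC)
  moreover have "T = Blinfun f o\<^sub>L A"
  proof (rule blinfun_eqI)
    fix x
    \<comment> \<open>A constant sequence is the witness, with the point \<open>A x\<close> as its
      own projection.\<close>
    have "polar_graph A T (A x) (T x)"
      unfolding polar_graph_def by (intro exI[of _ "\<lambda>_. x"] exI[of _ "A x"]) simp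
    then show "T x = (Blinfun f o\<^sub>L A) x"
      by (simp add: Uf f_eq)
  qed
  moreover have "norm (Blinfun f) \<le> 1"
    by (rule norm_blinfun_bound) (simp_all add: Uf norm_le[OF f])
  ultimately show ?thesis by blast
qed

text \<open>The operators agree on the range of \<open>A\<close>, by continuity on its closure, and
  both vanish on the kernel; every vector is a sum of two such parts.\<close>

lemma polar_isometry_unique:
  assumes A: "positive_operator A" and "U o\<^sub>L A = V o\<^sub>L A"
    and ker: "\<And>x. A x = 0 \<Longrightarrow> U x = 0 \<and> V x = 0"
  shows "U = V"
proof (rule blinfun_eqI)
  fix z
  obtain X m where X: "(\<lambda>n::nat. A (X n)) \<longlonglongrightarrow> m" "A (z - m) = 0"
    using positive_operator_decomposition[OF A] by blast
  have UV: "U (A x) = V (A x)" for x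
    using assms(2) by (metis blinfun_apply_blinfun_compose)
  have "U m = V m"
  proof (rule LIMSEQ_unique)
    show "(\<lambda>n. U (A (X n))) \<longlonglongrightarrow> U m" by (intro tendsto_intros X)
    show "(\<lambda>n. U (A (X n))) \<longlonglongrightarrow> V m" unfolding UV by (intro tendsto_intros X)
  qed
  with ker[OF X(2)] show "U z = V z"
    by (simp add: blinfun.diff_right)
qed

text \<open>The contraction bound is transferred from the constructed operator, which uniqueness
  identifies with \<open>polar_isometry T\<close>.\<close>

lemma polar_isometry:
  fixes T :: "'a::complex_hilbert_space \<Rightarrow>\<^sub>L 'a"
  assumes T: "complex_linear T"
  shows polar_decomposition: "T = polar_isometry T o\<^sub>L operator_abs T"
    and norm_polar_isometry_le: "norm (polar_isometry T) \<le> 1"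
proof -
  let ?A = "operator_abs T"
  let ?P = "\<lambda>U. partial_isometry U \<and> operator_kernel U = operator_kernel T \<and> T = U o\<^sub>L ?A"
  obtain U where U: "?P U" "norm U \<le> 1"
    using polar_isometry_exists[where A = "?A", OF T positive_operator_abs[OF T] norm_operator_abs_apply[OF T]]
    by blast
  have unique: "V = U" if V: "?P V" for V
  proof (rule polar_isometry_unique[OF positive_operator_abs[OF T]])
    show "V o\<^sub>L ?A = U o\<^sub>L ?A" using U V by metis
    show "V x = 0 \<and> U x = 0" if "?A x = 0" for x
    proof -
      have "x \<in> operator_kernel T"
        using that norm_operator_abs_apply[OF T, of x] by (simp add: operator_kernel_def)
      then show ?thesis using U V by (auto simp: operator_kernel_def)
    qed
  qed
  have eq: "polar_isometry T = U"
    unfolding polar_isometry_def by (rule the_equality) (rule U(1), rule unique)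
  show "T = polar_isometry T o\<^sub>L ?A" unfolding eq using U(1) by blast
  show "norm (polar_isometry T) \<le> 1" unfolding eq by (rule U(2))
qed


section \<open>The norm of the mean transform\<close>

text \<open>Vectors of norm at most 1, instead of exactly 1, cover the zero space too.\<close>

lemma norming_sequence:
  fixes F :: "'a::real_normed_vector \<Rightarrow>\<^sub>L 'b::real_normed_vector"
  obtains X where "\<And>n::nat. norm (X n) \<le> 1" "(\<lambda>n. norm (F (X n))) \<longlonglongrightarrow> norm F"
proof -
  have near: "\<exists>x. norm x \<le> 1 \<and> norm F - e \<le> norm (F x)" if e: "e > 0" for e
  proof (rule ccontr)
    assume *: "\<not> ?thesis"
    \<comment> \<open>The negated claim at 0 makes the candidate bound nonnegative, as an operator
      norm bound must be.\<close>
    then have pos: "norm F - e \<ge> 0" using not_le by (auto dest!: spec[of _ 0])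
    have "norm (F x) \<le> (norm F - e) * norm x" for x
    proof (cases "x = 0")
      case False
      then have "norm (F ((1 / norm x) *\<^sub>R x)) \<le> norm F - e"
        using * by (auto dest!: spec[of _ "(1 / norm x) *\<^sub>R x"])
      then show ?thesis using False by (simp add: blinfun.scaleR_right field_simps)
    qed simp
    then have "norm F \<le> norm F - e" using pos by (rule norm_blinfun_bound[rotated])
    with e show False by simp
  qed
  have "\<exists>x. norm x \<le> 1 \<and> norm F - inverse (real (Suc n)) \<le> norm (F x)" for n
    by (rule near) simp
  then obtain X where X: "\<And>n::nat. norm (X n) \<le> 1"
    "\<And>n::nat. norm F - inverse (real (Suc n)) \<le> norm (F (X n))" by metis
  have upper: "norm (F (X n)) \<le> norm F" for n
    using norm_blinfun[of F "X n"] mult_left_mono[OF X(1)[of n] norm_ge_zero[of F]] by simp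
  have "(\<lambda>n. norm F - inverse (real (Suc n))) \<longlonglongrightarrow> norm F"
    using tendsto_diff[OF tendsto_const LIMSEQ_inverse_real_of_nat, of "norm F"] by simp
  then have "(\<lambda>n. norm (F (X n))) \<longlonglongrightarrow> norm F"
    by (rule tendsto_sandwich[OF always_eventually[OF allI[OF X(2)]]
          always_eventually[OF allI[OF upper]] _ tendsto_const])
  with X(1) show ?thesis by (rule that)
qed

lemma norm_blinfun_ge_limit:
  fixes F :: "'a::real_normed_vector \<Rightarrow>\<^sub>L 'b::real_normed_vector"
  assumes "\<And>n::nat. norm (X n) \<le> 1" "(\<lambda>n. norm (F (X n))) \<longlonglongrightarrow> c"
  shows "c \<le> norm F"
proof (rule LIMSEQ_le_const2[OF assms(2)])
  have "norm (F (X n)) \<le> norm F" for n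
    using norm_blinfun[of F "X n"] mult_left_mono[OF assms(1)[of n] norm_ge_zero[of F]] by simp
  then show "\<exists>N. \<forall>n\<ge>N. norm (F (X n)) \<le> norm F" by blast
qed

lemma tendsto_norm_eqI:
  fixes f g :: "_ \<Rightarrow> 'a::real_normed_vector"
  assumes "((\<lambda>x. f x - g x) \<longlongrightarrow> 0) F" "((\<lambda>x. norm (f x)) \<longlongrightarrow> c) F"
  shows "((\<lambda>x. norm (g x)) \<longlongrightarrow> c) F"
proof (rule Lim_transform2[OF assms(2)])
  show "((\<lambda>x. norm (f x) - norm (g x)) \<longlongrightarrow> 0) F"
    by (rule Lim_null_comparison[OF _ tendsto_norm_zero[OF assms(1)]])
      (simp add: norm_triangle_ineq3)
qed

text \<open>The radius \<open>r\<close> is left free because the result serves both for vectors of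
  the unit ball and for their images under \<open>T\<close>, which have norm at most
  \<open>t\<close>.\<close>

lemma positive_operator_approx_eigenvector:
  fixes X :: "nat \<Rightarrow> 'a::complex_hilbert_space"
  assumes A: "positive_operator A" and t: "norm A \<le> t"
    and X: "\<And>n. norm (X n) \<le> r" and lim: "(\<lambda>n. norm (A (X n))) \<longlonglongrightarrow> t * r"
  shows "(\<lambda>n. A (X n) - t *\<^sub>R X n) \<longlonglongrightarrow> 0"
proof -
  have "(\<lambda>n. (norm (A (X n) - t *\<^sub>R X n))\<^sup>2) \<longlonglongrightarrow> 0"
  proof (rule tendsto_sandwich[of "\<lambda>_. 0"])
    have "(norm (X n))\<^sup>2 \<le> r\<^sup>2" for n
      using X by (simp add: power_mono)
    then have "(norm (A (X n) - t *\<^sub>R X n))\<^sup>2 \<le> t\<^sup>2 * r\<^sup>2 - (norm (A (X n)))\<^sup>2" for n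
      using norm_positive_operator_diff_sq_le[OF A t, of "X n"]
        mult_left_mono[of "(norm (X n))\<^sup>2" "r\<^sup>2" "t\<^sup>2"] by (smt (verit) zero_le_power2)
    then show "\<forall>\<^sub>F n in sequentially. (norm (A (X n) - t *\<^sub>R X n))\<^sup>2 \<le> t\<^sup>2 * r\<^sup>2 - (norm (A (X n)))\<^sup>2"
      by simp
    have "(\<lambda>n. t\<^sup>2 * r\<^sup>2 - (norm (A (X n)))\<^sup>2) \<longlonglongrightarrow> t\<^sup>2 * r\<^sup>2 - (t * r)\<^sup>2"
      by (intro tendsto_intros lim)
    then show "(\<lambda>n. t\<^sup>2 * r\<^sup>2 - (norm (A (X n)))\<^sup>2) \<longlonglongrightarrow> 0"
      by (simp add: power_mult_distrib)
  qed auto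
  then have "(\<lambda>n. sqrt ((norm (A (X n) - t *\<^sub>R X n))\<^sup>2)) \<longlonglongrightarrow> sqrt 0"
    by (rule tendsto_real_sqrt)
  then show ?thesis
    by (simp add: tendsto_norm_zero_iff)
qed

theorem theorem25:
  fixes T :: "'h::complex_hilbert_space \<Rightarrow>\<^sub>L 'h" and l :: real
  assumes "complex_linear T" and "l \<in> {0<..<1}"
  shows "norm (mean_transform l T) = norm T \<longleftrightarrow> norm (T o\<^sub>L T) = (norm T)\<^sup>2"
proof -
  define A U M t where "A = operator_abs T" and "U = polar_isometry T"
    and "M = mean_transform l T" and "t = norm T"
  have l: "0 < l" "l < 1" using assms(2) by auto
  have A: "positive_operator A" and AT: "norm (A x) = norm (T x)" for x
    unfolding A_def using operator_abs[OF assms(1)] by auto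
  have UA: "U (A x) = T x" for x
    using polar_decomposition[OF assms(1)] unfolding A_def U_def
    by (metis blinfun_apply_blinfun_compose)
  have U: "norm (U x) \<le> norm x" for x
    using norm_blinfun[of U x] norm_polar_isometry_le[OF assms(1)]
      mult_right_mono[of "norm U" 1 "norm x"] by (simp add: U_def)
  have t0: "0 \<le> t" by (simp add: t_def)
  have T: "norm (T x) \<le> t * norm x" for x
    unfolding t_def by (rule norm_blinfun)
  have normA: "norm A \<le> t"
    using T t0 by (intro norm_blinfun_bound) (simp_all add: AT)
  have M: "M x = l *\<^sub>R T x + (1 - l) *\<^sub>R A (U x)" for x
    by (simp add: M_def mean_transform_def duggal_transform_def A_def U_def blinfun.bilinear_simps)
  have TU: "norm (T (U x)) \<le> t * norm x" for x
    using T[of "U x"] mult_left_mono[OF U t0] by (rule order_trans)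
  have norm_M: "norm (M x) \<le> l * norm (T x) + (1 - l) * norm (T (U x))" for x
    unfolding M using l by (intro order_trans[OF norm_triangle_ineq]) (simp add: AT)
  have M_le: "norm M \<le> t"
  proof (rule norm_blinfun_bound[OF t0])
    fix x
    have "norm (M x) \<le> l * (t * norm x) + (1 - l) * (t * norm x)"
      using l by (intro order_trans[OF norm_M] add_mono mult_left_mono T TU) auto
    then show "norm (M x) \<le> t * norm x"
      by (simp add: algebra_simps)
  qed
  have TT_le: "norm (T o\<^sub>L T) \<le> t * t"
    unfolding t_def by (rule norm_blinfun_compose)
  have "norm M = t \<longleftrightarrow> norm (T o\<^sub>L T) = t\<^sup>2"
  proof
    assume Mt: "norm M = t"
    obtain X where X: "\<And>n::nat. norm (X n) \<le> 1" "(\<lambda>n. norm (M (X n))) \<longlonglongrightarrow> t"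
      using norming_sequence[of M] Mt by metis
    have TX: "norm (T (X n)) \<le> t" "norm (T (U (X n))) \<le> t" for n
      using T[of "X n"] TU[of "X n"] mult_left_mono[OF X(1)[of n] t0] by auto
    \<comment> \<open>The norm of \<open>M\<close> is bounded by a convex combination of two
      quantities that are at most \<open>t\<close>. If it tends to \<open>t\<close>, then so does
      each of them, since both weights are positive.\<close>
    have "(\<lambda>n. norm (T (X n))) \<longlonglongrightarrow> t"
    proof (rule tendsto_sandwich)
      have "(norm (M (X n)) - (1 - l) * t) / l \<le> norm (T (X n))" for n
        using norm_M[of "X n"] mult_left_mono[OF TX(2)[of n], of "1 - l"] l by (simp add: field_simps)
      then show "\<forall>\<^sub>F n in sequentially. (norm (M (X n)) - (1 - l) * t) / l \<le> norm (T (X n))"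
        by simp
      have "(\<lambda>n. (norm (M (X n)) - (1 - l) * t) / l) \<longlonglongrightarrow> (t - (1 - l) * t) / l"
        using l by (intro tendsto_intros X) simp
      then show "(\<lambda>n. (norm (M (X n)) - (1 - l) * t) / l) \<longlonglongrightarrow> t"
        using l by (simp add: algebra_simps)
    qed (use TX in auto)
    then have "(\<lambda>n. A (X n) - t *\<^sub>R X n) \<longlonglongrightarrow> 0"
      using positive_operator_approx_eigenvector[OF A normA, of X 1] X(1) by (simp add: AT)
    \<comment> \<open>Applying T U to the eigenvector defect of \<open>X n\<close> uses T U A = T
      T.\<close>
    then have "(\<lambda>n. T (U (A (X n) - t *\<^sub>R X n))) \<longlonglongrightarrow> T (U 0)"
      by (intro tendsto_intros)
    then have "(\<lambda>n. T (T (X n)) - t *\<^sub>R T (U (X n))) \<longlonglongrightarrow> 0"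
      by (simp add: blinfun.bilinear_simps UA)
    then have near: "(\<lambda>n. t *\<^sub>R T (U (X n)) - T (T (X n))) \<longlonglongrightarrow> 0"
      using tendsto_minus by force
    have "(\<lambda>n. norm (T (U (X n)))) \<longlonglongrightarrow> t"
    proof (rule tendsto_sandwich)
      have "norm (M (X n)) \<le> l * t + (1 - l) * norm (T (U (X n)))" for n
        using l by (intro order_trans[OF norm_M] add_mono mult_left_mono TX order_refl) auto
      then have "(norm (M (X n)) - l * t) / (1 - l) \<le> norm (T (U (X n)))" for n
        using l by (simp add: divide_le_eq mult.commute diff_le_eq add.commute)
      then show "\<forall>\<^sub>F n in sequentially. (norm (M (X n)) - l * t) / (1 - l) \<le> norm (T (U (X n)))"
        by simp
      have "(\<lambda>n. (norm (M (X n)) - l * t) / (1 - l)) \<longlonglongrightarrow> (t - l * t) / (1 - l)"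
        using l by (intro tendsto_intros X) simp
      moreover have "(t - l * t) / (1 - l) = t"
        using l by (simp add: field_simps)
      ultimately show "(\<lambda>n. (norm (M (X n)) - l * t) / (1 - l)) \<longlonglongrightarrow> t"
        by simp
    qed (use TX in auto)
    then have "(\<lambda>n. norm (t *\<^sub>R T (U (X n)))) \<longlonglongrightarrow> t * t"
      using t0 by (auto intro!: tendsto_intros)
    with near have "(\<lambda>n. norm ((T o\<^sub>L T) (X n))) \<longlonglongrightarrow> t * t"
      by (simp add: tendsto_norm_eqI)
    then have "t * t \<le> norm (T o\<^sub>L T)"
      by (rule norm_blinfun_ge_limit[OF X(1)])
    with TT_le show "norm (T o\<^sub>L T) = t\<^sup>2"
      by (simp add: power2_eq_square)
  next
    assume TTt: "norm (T o\<^sub>L T) = t\<^sup>2"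
    show "norm M = t"
    \<comment> \<open>Both the squeeze and the final combination below divide by
      \<open>t\<close>.\<close>
    proof (cases "t = 0")
      case True
      with M_le show ?thesis by simp
    next
      case False
      with t0 have t: "0 < t" by simp
      obtain X where X: "\<And>n::nat. norm (X n) \<le> 1" "(\<lambda>n. norm (T (T (X n)))) \<longlonglongrightarrow> t * t"
        using norming_sequence[of "T o\<^sub>L T", unfolded TTt power2_eq_square blinfun_apply_blinfun_compose]
        by blast
      have TX: "norm (T (X n)) \<le> t" for n
        using T[of "X n"] mult_left_mono[OF X(1)[of n] t0] by auto
      have limT: "(\<lambda>n. norm (T (X n))) \<longlonglongrightarrow> t"
      proof (rule tendsto_sandwich)
        \<comment> \<open>One factor \<open>T\<close> gains at most \<open>t\<close>, so norms of
          \<open>T (T (X n))\<close> near the square of \<open>t\<close> force norms of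
          \<open>T (X n)\<close> near \<open>t\<close>.\<close>
        have "norm (T (T (X n))) / t \<le> norm (T (X n))" for n
          using T[of "T (X n)"] t by (simp add: field_simps)
        then show "\<forall>\<^sub>F n in sequentially. norm (T (T (X n))) / t \<le> norm (T (X n))"
          by simp
        have "(\<lambda>n. norm (T (T (X n))) / t) \<longlonglongrightarrow> t * t / t"
          using t by (intro tendsto_intros X) simp
        then show "(\<lambda>n. norm (T (T (X n))) / t) \<longlonglongrightarrow> t"
          using t by simp
      qed (use TX in auto)
      then have "(\<lambda>n. A (X n) - t *\<^sub>R X n) \<longlonglongrightarrow> 0"
        using positive_operator_approx_eigenvector[OF A normA, of X 1] X(1) by (simp add: AT)
      \<comment> \<open>Here A U A = A T, so the Duggal transform \<open>A U\<close> enters through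
        the defect of \<open>X n\<close>.\<close>
      then have "(\<lambda>n. A (U (A (X n) - t *\<^sub>R X n))) \<longlonglongrightarrow> A (U 0)"
        by (intro tendsto_intros)
      then have 1: "(\<lambda>n. A (T (X n)) - t *\<^sub>R A (U (X n))) \<longlonglongrightarrow> 0"
        by (simp add: blinfun.bilinear_simps UA)
      \<comment> \<open>The second eigenvector defect is taken at \<open>T (X n)\<close>, with
        radius \<open>t\<close>: the norm of \<open>A (T (X n))\<close> is that of
        \<open>T (T (X n))\<close>.\<close>
      have 2: "(\<lambda>n. A (T (X n)) - t *\<^sub>R T (X n)) \<longlonglongrightarrow> 0"
        using positive_operator_approx_eigenvector[OF A normA, of "\<lambda>n. T (X n)" t] TX X(2)
        by (simp add: AT)
      \<comment> \<open>Subtracting the defects cancels \<open>A (T (X n))\<close> and leaves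
        \<open>t\<close> times T - A U at \<open>X n\<close>; the factor (1 - l) / t turns this into
        T - M.\<close>
      have "(\<lambda>n. ((1 - l) / t) *\<^sub>R ((A (T (X n)) - t *\<^sub>R A (U (X n))) - (A (T (X n)) - t *\<^sub>R T (X n))))
          \<longlonglongrightarrow> ((1 - l) / t) *\<^sub>R (0 - 0)"
        by (intro tendsto_intros 1 2)
      moreover have "((1 - l) / t) *\<^sub>R ((A (T x) - t *\<^sub>R A (U x)) - (A (T x) - t *\<^sub>R T x)) = T x - M x" for x
      proof -
        have "(A (T x) - t *\<^sub>R A (U x)) - (A (T x) - t *\<^sub>R T x) = t *\<^sub>R (T x - A (U x))"
          by (simp add: scaleR_diff_right)
        moreover have "(1 - l) / t * t = 1 - l"
          using t by simp
        ultimately show ?thesis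
          by (simp only: scaleR_scaleR) (simp add: M algebra_simps)
      qed
      ultimately have "(\<lambda>n. T (X n) - M (X n)) \<longlonglongrightarrow> 0"
        by simp
      then have "(\<lambda>n. norm (M (X n))) \<longlonglongrightarrow> t"
        using limT by (rule tendsto_norm_eqI)
      then have "t \<le> norm M"
        by (rule norm_blinfun_ge_limit[OF X(1)])
      with M_le show ?thesis by simp
    qed
  qed
  then show ?thesis by (simp add: M_def t_def)
qed

end
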